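(* Let $R$ be an integral domain with field of quotients $F$, and let $\mathfrak G$ be the matroid of a hyperplane arrangement on $[n]$. Then $\mathcal R^1_1(\mathfrak G,R)=\mathcal R^1(\mathfrak G,R)$, i.e. for $\lambda\in R^n$ one has $\dim_F Z(\lambda,F)\ge 2$ if and only if there exists $\eta\in R^n$ such that $(\lambda,\eta)$ is an $R$-resonant pair.
   Context: Let $\mathcal A=\{H_1,\dots,H_n\}$ be an arrangement of distinct linear hyperplanes in $\mathbb C^\ell$ and $\mathfrak G$ its matroid on $[n]=\{1,\dots,n\}$: the circuits are the minimal sets $C\subseteq[n]$ with $\operatorname{codim}\bigcap_{i\in C}H_i<|C|$. For a commutative ring $S$ with $1$, let $E_S(n)$ be the exterior algebra over $S$ on degree-one generators $e_1,\dots,e_n$, and let the Orlik–Solomon algebra $A_S(\mathfrak G)=E_S(n)/I$, where $I$ is the ideal generated by $\partial e_C=\sum_{k=1}^p(-1)^{k-1}e_{i_1}\wedge\cdots\widehat{e_{i_k}}\cdots\wedge e_{i_p}$ for all circuits $C=\{i_1<\dots<i_p\}$; let $a_i$ be the image of $e_i$ and $a_{\xi}=\sum_i\xi_ia_i$ for $\xi\in S^n$. Vectors $\xi,\nu\in S^n$ are parallel if all minors $\xi_i\nu_j-\xi_j\nu_i$ vanish. $Z(\lambda,S)=\{\eta\in S^n : a_\lambda\wedge a_\eta=0\text{ in }A_S(\mathfrak G)\}$. A pair $(\lambda,\eta)$ with $\eta\in Z(\lambda,S)$ not parallel to $\lambda$ is an ($S$-)resonant pair, and $\mathcal R^1(\mathfrak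 G,S)$ is the set of $\lambda\in S^n$ for which some $\eta$ makes $(\lambda,\eta)$ a resonant pair. For $R$ an integral domain with quotient field $F$ (so $R^n\subseteq F^n$), $\mathcal R^1_k(\mathfrak G,R)=\{\lambda\in R^n : \dim_F Z(\lambda,F)\ge k+1\}$.
   Formalization: The zero vector is removed from R^1_1: as printed the equality fails at λ=0 when n≥2, since Z(0,F)=F^n has dimension n≥2 while every η is parallel to 0; the equivalence is stated for all λ≠0, together with 0∉R^1, and for n≥1. *)

theory Defs
  imports
    "HOL-Analysis.Cartesian_Space"
    "HOL-Algebra.QuotRing"
    "HOL-Computational_Algebra.Fraction_Field"
begin

section \<open>Hyperplane arrangements and their matroids\<close>

text \<open>
  Throughout, the index set $[n]$ with its order is a nonempty finite linearly ordered type \<open>'n\<close>,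
  $n$ is \<open>CARD('n)\<close>, and $S^n$ is \<open>'s ^ 'n\<close>.
\<close>

definition codim :: "('k::field ^ 'l) set \<Rightarrow> nat" where
  "codim V = CARD('l) - vec.dim V"

definition linear_hyperplane :: "('k::field ^ 'l) set \<Rightarrow> bool" where
  "linear_hyperplane V \<longleftrightarrow> vec.subspace V \<and> codim V = 1"

definition hyperplane_arrangement :: "('n \<Rightarrow> (complex ^ 'l) set) \<Rightarrow> bool" where
  "hyperplane_arrangement H \<longleftrightarrow> (\<forall>i. linear_hyperplane (H i)) \<and> inj H"

definition dependent_set :: "('n \<Rightarrow> (complex ^ 'l) set) \<Rightarrow> 'n set \<Rightarrow> bool" where
  "dependent_set H C \<longleftrightarrow> codim (\<Inter>i\<in>C. H i) < card C"

text \<open>A matroid is represented by its set of circuits.\<close>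

definition arr_matroid :: "('n \<Rightarrow> (complex ^ 'l) set) \<Rightarrow> 'n set set" where
  "arr_matroid H = {C. dependent_set H C \<and> (\<forall>D. D \<subset> C \<longrightarrow> \<not> dependent_set H D)}"


section \<open>The exterior algebra\<close>

text \<open>
  The free \<open>'s\<close>-module with basis $e_I$, $I \subseteq [n]$, where $e_I$ stands for
  $e_{i_1} \wedge \dots \wedge e_{i_p}$ if $I = \{i_1 < \dots < i_p\}$. An element is given by its
  coefficients. The product is determined by $e_I \wedge e_J = \pm e_{I \cup J}$ for disjoint
  $I, J$, the sign being that of the permutation that sorts $I$ followed by $J$, and
  $e_I \wedge e_J = 0$ otherwise.
\<close>

definition shuffle_sign :: "'n::linorder set \<Rightarrow> 'n set \<Rightarrow> 's::comm_ring_1" where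
  "shuffle_sign I J = (- 1) ^ card {(i, j). i \<in> I \<and> j \<in> J \<and> j < i}"

definition wedge ::
    "('n::linorder set \<Rightarrow> 's::comm_ring_1) \<Rightarrow> ('n set \<Rightarrow> 's) \<Rightarrow> 'n set \<Rightarrow> 's" where
  "wedge x y = (\<lambda>K. \<Sum>I\<in>Pow K. shuffle_sign I (K - I) * x I * y (K - I))"

definition ext_algebra :: "('n::{finite,linorder} set \<Rightarrow> 's::comm_ring_1) ring" where
  "ext_algebra =
    \<lparr>carrier = UNIV, mult = wedge, one = (\<lambda>K. if K = {} then 1 else 0),
     zero = (\<lambda>K. 0), add = (\<lambda>x y K. x K + y K)\<rparr>"

definition ext_basis :: "'n set \<Rightarrow> 'n set \<Rightarrow> 's::comm_ring_1" where
  "ext_basis I = (\<lambda>K. if K = I then 1 else 0)"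

definition ext_gen :: "'n \<Rightarrow> 'n set \<Rightarrow> 's::comm_ring_1" where
  "ext_gen i = ext_basis {i}"

definition ext_scalar :: "'s::comm_ring_1 \<Rightarrow> 'n set \<Rightarrow> 's" where
  "ext_scalar c = (\<lambda>K. if K = {} then c else 0)"

text \<open>
  $\partial e_C$: the element in position $k$ of $C$ is the one with $k - 1$ predecessors in $C$.
\<close>

definition ext_boundary :: "'n::linorder set \<Rightarrow> 'n set \<Rightarrow> 's::comm_ring_1" where
  "ext_boundary C = (\<lambda>K. \<Sum>i\<in>C. (- 1) ^ card {j \<in> C. j < i} * ext_basis (C - {i}) K)"


subsection \<open>It is a ring, generated as expected\<close>

lemma shuffle_sign_empty [simp]: "shuffle_sign {} J = 1" "shuffle_sign I {} = 1"
  by (simp_all add: shuffle_sign_def)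

lemma shuffle_sign_Un_left:
  fixes I J L :: "'n::{finite,linorder} set"
  assumes "I \<inter> J = {}"
  shows "shuffle_sign (I \<union> J) L = shuffle_sign I L * (shuffle_sign J L :: 's::comm_ring_1)"
proof -
  have "{(i, j). i \<in> I \<union> J \<and> j \<in> L \<and> j < i} =
      {(i, j). i \<in> I \<and> j \<in> L \<and> j < i} \<union> {(i, j). i \<in> J \<and> j \<in> L \<and> j < i}" by auto
  then have "card {(i, j). i \<in> I \<union> J \<and> j \<in> L \<and> j < i} =
      card {(i, j). i \<in> I \<and> j \<in> L \<and> j < i} + card {(i, j). i \<in> J \<and> j \<in> L \<and> j < i}"
    using assms by (simp add: card_Un_disjoint disjoint_iff)
  then show ?thesis by (simp add: shuffle_sign_def power_add)
qed

lemma shuffle_sign_Un_right: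
  fixes I J L :: "'n::{finite,linorder} set"
  assumes "J \<inter> L = {}"
  shows "shuffle_sign I (J \<union> L) = shuffle_sign I J * (shuffle_sign I L :: 's::comm_ring_1)"
proof -
  have "{(i, j). i \<in> I \<and> j \<in> J \<union> L \<and> j < i} =
      {(i, j). i \<in> I \<and> j \<in> J \<and> j < i} \<union> {(i, j). i \<in> I \<and> j \<in> L \<and> j < i}" by auto
  then have "card {(i, j). i \<in> I \<and> j \<in> J \<union> L \<and> j < i} =
      card {(i, j). i \<in> I \<and> j \<in> J \<and> j < i} + card {(i, j). i \<in> I \<and> j \<in> L \<and> j < i}"
    using assms by (simp add: card_Un_disjoint disjoint_iff)
  then show ?thesis by (simp add: shuffle_sign_def power_add)
qed

lemma wedge_assoc:
  fixes x y z :: "'n::{finite,linorder} set \<Rightarrow> 's::comm_ring_1"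
  shows "wedge (wedge x y) z = wedge x (wedge y z)"
proof
  fix K
  let ?s = "shuffle_sign :: 'n set \<Rightarrow> 'n set \<Rightarrow> 's"
  let ?f = "\<lambda>M I. ?s M (K - M) * (?s I (M - I) * x I * y (M - I)) * z (K - M)"
  let ?g = "\<lambda>I J. ?s I (K - I) * x I * (?s J (K - I - J) * y J * z (K - I - J))"
  have "wedge (wedge x y) z K = (\<Sum>M\<in>Pow K. \<Sum>I\<in>Pow M. ?f M I)"
    unfolding wedge_def by (simp add: sum_distrib_left sum_distrib_right)
  also have "\<dots> = (\<Sum>(M, I)\<in>(SIGMA M:Pow K. Pow M). ?f M I)"
    by (rule sum.Sigma) auto
  also have "\<dots> = (\<Sum>(I, J)\<in>(SIGMA I:Pow K. Pow (K - I)). ?g I J)"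
  proof (rule sum.reindex_bij_witness[where i = "\<lambda>(I, J). (I \<union> J, I)" and j = "\<lambda>(M, I). (I, M - I)"])
    fix a assume a: "a \<in> (SIGMA M:Pow K. Pow M)"
    obtain M I where [simp]: "a = (M, I)" by force
    from a have MI: "M \<subseteq> K" "I \<subseteq> M" by auto
    define J L where "J = M - I" and "L = K - M"
    have M: "M = I \<union> J" and KI: "K - I = J \<union> L" and KIJ: "K - I - J = L"
      and d: "I \<inter> J = {}" "J \<inter> L = {}"
      using MI by (auto simp: J_def L_def)
    have "?s M L * ?s I J = ?s I (K - I) * ?s J L"
      using d unfolding KI unfolding M
      by (simp add: shuffle_sign_Un_left shuffle_sign_Un_right mult_ac)
    then have "?f M I = (?s I (K - I) * ?s J L) * x I * y J * z L"
      by (simp add: J_def L_def mult_ac)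
    then have "?f M I = ?g I J"
      by (simp add: KIJ mult_ac)
    then show "(case case a of (M, I) \<Rightarrow> (I, M - I) of (I, J) \<Rightarrow> ?g I J) = (case a of (M, I) \<Rightarrow> ?f M I)"
      by (simp add: J_def)
  qed auto
  also have "\<dots> = (\<Sum>I\<in>Pow K. \<Sum>J\<in>Pow (K - I). ?g I J)"
    by (rule sum.Sigma[symmetric]) auto
  also have "\<dots> = wedge x (wedge y z) K"
    unfolding wedge_def by (simp add: sum_distrib_left)
  finally show "wedge (wedge x y) z K = wedge x (wedge y z) K" .
qed

lemma wedge_ext_scalar:
  fixes x :: "'n::{finite,linorder} set \<Rightarrow> 's::comm_ring_1"
  shows "wedge (ext_scalar c) x = (\<lambda>K. c * x K)" "wedge x (ext_scalar c) = (\<lambda>K. x K * c)"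
proof -
  have "(\<Sum>I\<in>Pow K. shuffle_sign I (K - I) * ext_scalar c I * x (K - I)) =
      (\<Sum>I\<in>{{}}. shuffle_sign I (K - I) * ext_scalar c I * x (K - I))" for K
    by (rule sum.mono_neutral_right) (auto simp: ext_scalar_def)
  then show "wedge (ext_scalar c) x = (\<lambda>K. c * x K)"
    by (simp add: wedge_def ext_scalar_def)
  have "(\<Sum>I\<in>Pow K. shuffle_sign I (K - I) * x I * ext_scalar c (K - I)) =
      (\<Sum>I\<in>{K}. shuffle_sign I (K - I) * x I * ext_scalar c (K - I))" for K
    by (rule sum.mono_neutral_right) (auto simp: ext_scalar_def)
  then show "wedge x (ext_scalar c) = (\<lambda>K. x K * c)"
    by (simp add: wedge_def ext_scalar_def)
qed

lemma ext_algebra_ring: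
  "ring (ext_algebra :: ('n::{finite,linorder} set \<Rightarrow> 's::comm_ring_1) ring)"
proof (rule ringI)
  show "abelian_group (ext_algebra :: ('n set \<Rightarrow> 's) ring)"
  proof (rule abelian_groupI)
    fix x :: "'n set \<Rightarrow> 's"
    show "\<exists>y\<in>carrier ext_algebra. y \<oplus>\<^bsub>ext_algebra\<^esub> x = \<zero>\<^bsub>ext_algebra\<^esub>"
      by (rule bexI[where x = "\<lambda>K. - x K"]) (auto simp: ext_algebra_def)
  qed (auto simp: ext_algebra_def algebra_simps)
  have one: "(\<lambda>K. if K = {} then 1 else 0) = (ext_scalar 1 :: 'n set \<Rightarrow> 's)"
    by (simp add: ext_scalar_def)
  show "Group.monoid (ext_algebra :: ('n set \<Rightarrow> 's) ring)"
    by (rule monoidI) (auto simp: ext_algebra_def wedge_assoc one wedge_ext_scalar)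
qed (auto simp: ext_algebra_def wedge_def algebra_simps sum.distrib)

lemma ext_basis_empty: "ext_basis {} = \<one>\<^bsub>ext_algebra\<^esub>"
  by (simp add: ext_basis_def ext_algebra_def)

lemma ext_basis_wedge:
  fixes I J :: "'n::{finite,linorder} set"
  shows "wedge (ext_basis I) (ext_basis J) =
    (\<lambda>K. if I \<inter> J = {} then shuffle_sign I J * ext_basis (I \<union> J) K else (0 :: 's::comm_ring_1))"
proof
  fix K
  have "wedge (ext_basis I) (ext_basis J) K =
      (\<Sum>M\<in>Pow K. if M = I then shuffle_sign I (K - I) * (ext_basis J (K - I) :: 's) else 0)"
    unfolding wedge_def by (rule sum.cong) (auto simp: ext_basis_def)
  also have "\<dots> = (if I \<subseteq> K then shuffle_sign I (K - I) * ext_basis J (K - I) else 0)"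
    by (simp add: sum.delta)
  also have "\<dots> = (if I \<inter> J = {} then shuffle_sign I J * ext_basis (I \<union> J) K else 0)"
  proof (cases "I \<subseteq> K \<and> K - I = J")
    case True
    then have "I \<inter> J = {}" "K = I \<union> J" by auto
    then show ?thesis using True by (simp add: ext_basis_def)
  next
    case False
    then have "\<not> (I \<inter> J = {} \<and> K = I \<union> J)" by auto
    then show ?thesis using False by (auto simp: ext_basis_def)
  qed
  finally show "wedge (ext_basis I) (ext_basis J) K =
      (if I \<inter> J = {} then shuffle_sign I J * ext_basis (I \<union> J) K else (0 :: 's))" .
qed

lemma ext_basis_insert:
  fixes I :: "'n::{finite,linorder} set"
  assumes "\<forall>j\<in>I. i < j"
  shows "wedge (ext_gen i) (ext_basis I) = (ext_basis (insert i I) :: _ \<Rightarrow> 's::comm_ring_1)"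
proof -
  have none: "{(k, j). k \<in> {i} \<and> j \<in> I \<and> j < k} = {}" using assms by auto
  have sgn: "shuffle_sign {i} I = (1::'s)"
    unfolding shuffle_sign_def none by simp
  have "{i} \<inter> I = {}" using assms by auto
  then show ?thesis by (simp add: ext_gen_def ext_basis_wedge sgn)
qed

lemma ext_gen_square: "wedge (ext_gen i) (ext_gen (i :: 'n::{finite,linorder})) = (\<lambda>K. 0)"
  by (simp add: ext_gen_def ext_basis_wedge)

lemma ext_gen_anticommute:
  fixes i j :: "'n::{finite,linorder}"
  assumes "i < j"
  shows "wedge (ext_gen j) (ext_gen i) = (\<lambda>K. - wedge (ext_gen i) (ext_gen j) K :: 's::comm_ring_1)"
proof -
  have inv: "{(k, l). k \<in> {i} \<and> l \<in> {j} \<and> l < k} = {}"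
      "{(k, l). k \<in> {j} \<and> l \<in> {i} \<and> l < k} = {(j, i)}"
    using assms by auto
  have sgn: "shuffle_sign {i} {j} = (1::'s)" "shuffle_sign {j} {i} = (- 1::'s)"
    unfolding shuffle_sign_def inv by simp_all
  have "{i, j} = {j, i}" by auto
  then show ?thesis using assms by (auto simp: ext_gen_def ext_basis_wedge sgn)
qed


section \<open>The Orlik--Solomon algebra\<close>

definition os_ideal :: "'n::{finite,linorder} set set \<Rightarrow> ('n set \<Rightarrow> 's::comm_ring_1) set" where
  "os_ideal \<GG> = Idl\<^bsub>ext_algebra\<^esub> (ext_boundary ` \<GG>)"

definition os_algebra :: "'n::{finite,linorder} set set \<Rightarrow> ('n set \<Rightarrow> 's::comm_ring_1) set ring" where
  "os_algebra \<GG> = ext_algebra Quot os_ideal \<GG>"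

definition os_class ::
    "'n::{finite,linorder} set set \<Rightarrow> ('n set \<Rightarrow> 's::comm_ring_1) \<Rightarrow> ('n set \<Rightarrow> 's) set" where
  "os_class \<GG> x = os_ideal \<GG> +>\<^bsub>ext_algebra\<^esub> x"

definition os_gen :: "'n::{finite,linorder} set set \<Rightarrow> 'n \<Rightarrow> ('n set \<Rightarrow> 's::comm_ring_1) set" where
  "os_gen \<GG> i = os_class \<GG> (ext_gen i)"

text \<open>$a_\xi = \sum_i \xi_i a_i$; a scalar acts as multiplication by its image in the algebra.\<close>

definition os_form ::
    "'n set set \<Rightarrow> 's::comm_ring_1 ^ 'n::{finite,linorder} \<Rightarrow> ('n set \<Rightarrow> 's) set" where
  "os_form \<GG> \<xi> =
    (\<Oplus>\<^bsub>os_algebra \<GG>\<^esub> i\<in>UNIV. os_class \<GG> (ext_scalar (\<xi> $ i)) \<otimes>\<^bsub>os_algebra \<GG>\<^esub> os_gen \<GG> i)"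

lemma os_form_eq: "os_form \<GG> \<xi> = os_class \<GG> (\<lambda>K. \<Sum>i\<in>UNIV. \<xi> $ i * ext_gen i K)"
proof -
  interpret E: ring "ext_algebra :: ('a set \<Rightarrow> 'b) ring" by (rule ext_algebra_ring)
  have "ideal (os_ideal \<GG> :: ('a set \<Rightarrow> 'b) set) ext_algebra"
    unfolding os_ideal_def by (rule E.genideal_ideal) (simp add: ext_algebra_def)
  then interpret h: ring_hom_ring ext_algebra "os_algebra \<GG> :: ('a set \<Rightarrow> 'b) set ring" "os_class \<GG>"
    using ideal.rcos_ring_hom_ring unfolding os_algebra_def os_class_def by blast
  have carr [simp]: "x \<in> carrier ext_algebra" for x :: "'a set \<Rightarrow> 'b"
    by (simp add: ext_algebra_def)
  have add: "x \<oplus>\<^bsub>ext_algebra\<^esub> y = (\<lambda>K. x K + y K)"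
    and zero: "\<zero>\<^bsub>ext_algebra\<^esub> = (\<lambda>K. 0 :: 'b)" for x y :: "'a set \<Rightarrow> 'b"
    by (simp_all add: ext_algebra_def)
  have mult: "os_class \<GG> (wedge x y) = os_class \<GG> x \<otimes>\<^bsub>os_algebra \<GG>\<^esub> os_class \<GG> y" for x y :: "'a set \<Rightarrow> 'b"
    using h.hom_mult[of x y] by (simp add: ext_algebra_def)
  have "(\<Oplus>\<^bsub>os_algebra \<GG>\<^esub>i\<in>A. os_class \<GG> (wedge (ext_scalar (\<xi> $ i)) (ext_gen i))) =
      os_class \<GG> (\<lambda>K. \<Sum>i\<in>A. \<xi> $ i * ext_gen i K)" if "finite A" for A
    using that
  proof (induction A)
    case empty
    show ?case using h.hom_zero by (simp add: zero)
  next
    case (insert i A)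
    let ?y = "\<lambda>K. \<Sum>j\<in>A. \<xi> $ j * ext_gen j K"
    have "os_class \<GG> (\<lambda>K. \<Sum>j\<in>insert i A. \<xi> $ j * ext_gen j K) =
        os_class \<GG> (wedge (ext_scalar (\<xi> $ i)) (ext_gen i) \<oplus>\<^bsub>ext_algebra\<^esub> ?y)"
      using insert.hyps by (simp add: add wedge_ext_scalar)
    also have "\<dots> = os_class \<GG> (wedge (ext_scalar (\<xi> $ i)) (ext_gen i)) \<oplus>\<^bsub>os_algebra \<GG>\<^esub> os_class \<GG> ?y"
      by (rule h.hom_add) simp_all
    finally show ?case using insert by (simp add: Pi_def)
  qed
  then show ?thesis by (simp add: os_form_def os_gen_def mult)
qed


section \<open>Resonance\<close>

definition vec_parallel :: "'s::comm_ring_1 ^ 'n \<Rightarrow> 's ^ 'n \<Rightarrow> bool" where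
  "vec_parallel \<xi> \<nu> \<longleftrightarrow> (\<forall>i j. \<xi> $ i * \<nu> $ j - \<xi> $ j * \<nu> $ i = 0)"

definition Z_set ::
    "'n set set \<Rightarrow> 's::comm_ring_1 ^ 'n::{finite,linorder} \<Rightarrow> ('s ^ 'n::{finite,linorder}) set" where
  "Z_set \<GG> \<xi> = {\<eta>. os_form \<GG> \<xi> \<otimes>\<^bsub>os_algebra \<GG>\<^esub> os_form \<GG> \<eta> = \<zero>\<^bsub>os_algebra \<GG>\<^esub>}"

definition resonant_pair ::
    "'n set set \<Rightarrow> 's::comm_ring_1 ^ 'n::{finite,linorder} \<Rightarrow> 's ^ 'n::{finite,linorder} \<Rightarrow> bool" where
  "resonant_pair \<GG> \<xi> \<eta> \<longleftrightarrow> \<eta> \<in> Z_set \<GG> \<xi> \<and> \<not> vec_parallel \<eta> \<xi>"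

definition resonance :: "'n set set \<Rightarrow> ('s::comm_ring_1 ^ 'n::{finite,linorder}) set" where
  "resonance \<GG> = {\<xi>. \<exists>\<eta>. resonant_pair \<GG> \<xi> \<eta>}"

definition to_quotient_field :: "'r::idom ^ 'n \<Rightarrow> 'r fract ^ 'n" where
  "to_quotient_field \<xi> = (\<chi> i. Fract (\<xi> $ i) 1)"

text \<open>
  $\mathcal{R}^1_k$. For $k < n$ it contains the zero vector, which is parallel to every vector
  and hence never part of a resonant pair.
\<close>

definition resonance_depth :: "nat \<Rightarrow> 'n set set \<Rightarrow> ('r::idom ^ 'n::{finite,linorder}) set" where
  "resonance_depth k \<GG> = {\<xi>. vec.dim (Z_set \<GG> (to_quotient_field \<xi>)) \<ge> k + 1}"

end

theory Submission
  imports Defs "HOL-Computational_Algebra.Polynomial_Factorial"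
begin

text \<open>
  Up to a nonzero scalar of $R$, every element of the ideal of relations over $F$ comes from the
  ideal over $R$: the elements with this property form an ideal that contains the generators.
  Hence a solution $\eta \in F^n$ of $a_\lambda \wedge a_\eta = 0$ becomes a solution over $R$ after
  multiplication by a suitable element of $R$. If $\lambda \neq 0$, then $\lambda \in Z(\lambda, F)$
  spans a line, so the dimension is at least 2 iff some $\eta \in Z(\lambda, F)$ is not parallel to
  $\lambda$.
\<close>

section \<open>Ideals of the exterior algebra\<close>

text \<open>Negatives come for free: -x is the product of the scalar -1 with x, so closure under
  products on one side already yields an additive subgroup.\<close>

lemma ideal_ext_algebraI:
  fixes J :: "('n::{finite,linorder} set \<Rightarrow> 's::comm_ring_1) set"
  assumes zero: "(\<lambda>K. 0) \<in> J"
    and add: "\<And>x y. x \<in> J \<Longrightarrow> y \<in> J \<Longrightarrow> (\<lambda>K. x K + y K) \<in> J"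
    and left: "\<And>a x. x \<in> J \<Longrightarrow> wedge a x \<in> J"
    and right: "\<And>a x. x \<in> J \<Longrightarrow> wedge x a \<in> J"
  shows "ideal J ext_algebra"
proof (rule idealI[OF ext_algebra_ring])
  interpret E: ring "ext_algebra :: ('n set \<Rightarrow> 's) ring" by (rule ext_algebra_ring)
  show "subgroup J (add_monoid ext_algebra)"
  proof (rule subgroup.intro)
    fix x assume x: "x \<in> J"
    have "\<ominus>\<^bsub>ext_algebra\<^esub> x = wedge (ext_scalar (- 1)) x"
      by (rule E.minus_equality) (auto simp: ext_algebra_def wedge_ext_scalar)
    then show "inv\<^bsub>add_monoid ext_algebra\<^esub> x \<in> J"
      using left[OF x] by (simp add: a_inv_def)
  qed (auto simp: ext_algebra_def zero add)
qed (auto simp: ext_algebra_def left right)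

lemma ideal_os_ideal:
  "ideal (os_ideal \<GG> :: ('n::{finite,linorder} set \<Rightarrow> 's::comm_ring_1) set) ext_algebra"
  unfolding os_ideal_def
  by (rule ring.genideal_ideal[OF ext_algebra_ring]) (simp add: ext_algebra_def)

lemma os_ideal_zero: "(\<lambda>K. 0) \<in> os_ideal \<GG>"
  using additive_subgroup.zero_closed[OF ideal.axioms(1)[OF ideal_os_ideal]]
  by (simp add: ext_algebra_def)

lemma os_ideal_add: "x \<in> os_ideal \<GG> \<Longrightarrow> y \<in> os_ideal \<GG> \<Longrightarrow> (\<lambda>K. x K + y K) \<in> os_ideal \<GG>"
  using additive_subgroup.a_closed[OF ideal.axioms(1)[OF ideal_os_ideal], of x \<GG> y]
  by (simp add: ext_algebra_def)

lemma os_ideal_wedge_left: "x \<in> os_ideal \<GG> \<Longrightarrow> wedge a x \<in> os_ideal \<GG>"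
  using ideal.I_l_closed[OF ideal_os_ideal, of x \<GG> a] by (simp add: ext_algebra_def)

lemma os_ideal_wedge_right: "x \<in> os_ideal \<GG> \<Longrightarrow> wedge x a \<in> os_ideal \<GG>"
  using ideal.I_r_closed[OF ideal_os_ideal, of x \<GG> a] by (simp add: ext_algebra_def)

lemma os_ideal_scale: "x \<in> os_ideal \<GG> \<Longrightarrow> (\<lambda>K. c * x K) \<in> os_ideal \<GG>"
  using os_ideal_wedge_left[of x \<GG> "ext_scalar c"] by (simp add: wedge_ext_scalar)

lemma ext_boundary_in_os_ideal: "C \<in> \<GG> \<Longrightarrow> ext_boundary C \<in> os_ideal \<GG>"
  using ring.genideal_self[OF ext_algebra_ring, of "ext_boundary ` \<GG>"]
  by (auto simp: os_ideal_def ext_algebra_def)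

text \<open>This serves as an induction principle: a property that cuts out an ideal and holds for
  the boundaries of circuits holds for all relations.\<close>

lemma os_ideal_minimal:
  assumes "ideal J ext_algebra" and "\<And>C. C \<in> \<GG> \<Longrightarrow> ext_boundary C \<in> J"
  shows "os_ideal \<GG> \<subseteq> J"
  unfolding os_ideal_def
  using assms by (intro ring.genideal_minimal[OF ext_algebra_ring]) auto


section \<open>Linear forms\<close>

definition linear_form :: "'s::comm_ring_1 ^ 'n \<Rightarrow> 'n::finite set \<Rightarrow> 's" where
  "linear_form \<xi> = (\<lambda>K. \<Sum>i\<in>UNIV. \<xi> $ i * ext_gen i K)"

text \<open>Passing to representatives moves resonance into the exterior algebra, where elements
  over R and over F can be compared coefficient by coefficient.\<close>

lemma Z_set_iff:
  fixes \<xi> \<eta> :: "'s::comm_ring_1 ^ 'n::{finite,linorder}"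
  shows "\<eta> \<in> Z_set \<GG> \<xi> \<longleftrightarrow> wedge (linear_form \<xi>) (linear_form \<eta>) \<in> os_ideal \<GG>"
proof -
  interpret I: ideal "os_ideal \<GG> :: ('n set \<Rightarrow> 's) set" ext_algebra
    by (rule ideal_os_ideal)
  interpret h: ring_hom_ring ext_algebra "os_algebra \<GG> :: ('n set \<Rightarrow> 's) set ring" "os_class \<GG>"
    using I.rcos_ring_hom_ring unfolding os_algebra_def os_class_def .
  let ?w = "wedge (linear_form \<xi>) (linear_form \<eta>)"
  have "os_form \<GG> \<xi> \<otimes>\<^bsub>os_algebra \<GG>\<^esub> os_form \<GG> \<eta> = os_class \<GG> ?w"
    using h.hom_mult[of "linear_form \<xi>" "linear_form \<eta>"]
    by (simp add: os_form_eq linear_form_def ext_algebra_def)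
  moreover have "os_class \<GG> ?w = \<zero>\<^bsub>os_algebra \<GG>\<^esub> \<longleftrightarrow> ?w \<in> os_ideal \<GG>"
    using I.rcos_const_imp_mem[of ?w] ring.a_rcos_zero[OF ext_algebra_ring ideal_os_ideal, of ?w]
    by (auto simp: os_class_def os_algebra_def FactRing_def ext_algebra_def)
  ultimately show ?thesis by (simp add: Z_set_def)
qed

lemma wedge_scale_right: "wedge x (\<lambda>K. c * y K) = (\<lambda>K. c * wedge x y K)"
  by (simp add: wedge_def sum_distrib_left mult_ac)

lemma wedge_linear_form:
  fixes \<xi> \<eta> :: "'s::comm_ring_1 ^ 'n::{finite,linorder}"
  shows "wedge (linear_form \<xi>) (linear_form \<eta>) K =
    (\<Sum>i\<in>UNIV. \<Sum>j\<in>UNIV. \<xi> $ i * \<eta> $ j * wedge (ext_gen i) (ext_gen j) K)"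
proof -
  have "wedge (linear_form \<xi>) (linear_form \<eta>) K =
      (\<Sum>I\<in>Pow K. \<Sum>i\<in>UNIV. \<Sum>j\<in>UNIV.
        \<xi> $ i * \<eta> $ j * (shuffle_sign I (K - I) * ext_gen i I * ext_gen j (K - I)))"
    by (simp add: wedge_def linear_form_def sum_distrib_left sum_distrib_right mult_ac)
  also have "\<dots> = (\<Sum>i\<in>UNIV. \<Sum>I\<in>Pow K. \<Sum>j\<in>UNIV.
        \<xi> $ i * \<eta> $ j * (shuffle_sign I (K - I) * ext_gen i I * ext_gen j (K - I)))"
    by (rule sum.swap)
  also have "\<dots> = (\<Sum>i\<in>UNIV. \<Sum>j\<in>UNIV. \<Sum>I\<in>Pow K.
        \<xi> $ i * \<eta> $ j * (shuffle_sign I (K - I) * ext_gen i I * ext_gen j (K - I)))"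
    by (intro sum.cong refl sum.swap)
  finally show ?thesis by (simp add: wedge_def sum_distrib_left)
qed

text \<open>In the double sum the diagonal vanishes because generators square to zero, and the terms
  for (i, j) and (j, i) cancel by anticommutativity. No division by 2 occurs, so any characteristic
  is allowed.\<close>

lemma wedge_linear_form_self:
  fixes \<xi> :: "'s::comm_ring_1 ^ 'n::{finite,linorder}"
  shows "wedge (linear_form \<xi>) (linear_form \<xi>) = (\<lambda>K. 0)"
proof
  fix K
  let ?g = "\<lambda>(i, j). \<xi> $ i * \<xi> $ j * wedge (ext_gen i) (ext_gen j) K"
  let ?L = "{(i, j). i < j} :: ('n \<times> 'n) set" and ?G = "{(i, j). j < i} :: ('n \<times> 'n) set"
  have "wedge (linear_form \<xi>) (linear_form \<xi>) K = sum ?g UNIV"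
    unfolding wedge_linear_form sum.cartesian_product by simp
  also have "\<dots> = sum ?g (?L \<union> ?G)"
    by (rule sum.mono_neutral_right) (auto simp: not_less_iff_gr_or_eq ext_gen_square)
  also have "\<dots> = sum ?g ?L + sum ?g ?G"
    by (rule sum.union_disjoint) auto
  also have "sum ?g ?G = sum (\<lambda>p. - ?g p) ?L"
    by (rule sum.reindex_bij_witness[where i = prod.swap and j = prod.swap])
      (auto simp: ext_gen_anticommute mult_ac)
  finally show "wedge (linear_form \<xi>) (linear_form \<xi>) K = 0"
    by (simp add: sum_negf)
qed

lemma Z_set_self: "\<xi> \<in> Z_set \<GG> \<xi>"
  by (simp add: Z_set_iff wedge_linear_form_self os_ideal_zero)


section \<open>Extension of scalars to the quotient field\<close>

lemma to_fract_sum: "to_fract (sum f A) = (\<Sum>i\<in>A. to_fract (f i))"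
  by (induction A rule: infinite_finite_induct) simp_all

lemma to_fract_power: "to_fract (x ^ k) = to_fract x ^ k"
  by (induction k) simp_all

lemma to_fract_shuffle_sign: "to_fract (shuffle_sign I J) = shuffle_sign I J"
  by (simp add: shuffle_sign_def to_fract_power)

text \<open>The structure constants of the exterior algebra are 0 and signs, which
  \<open>to_fract\<close> preserves.\<close>

lemma wedge_to_fract:
  "wedge (\<lambda>K. to_fract (x K)) (\<lambda>K. to_fract (y K)) = (\<lambda>K. to_fract (wedge x y K))"
  by (simp add: wedge_def to_fract_sum to_fract_shuffle_sign)

lemma ext_basis_to_fract: "ext_basis I K = to_fract (ext_basis I K)"
  by (simp add: ext_basis_def)

lemma ext_boundary_to_fract: "ext_boundary C = (\<lambda>K. to_fract (ext_boundary C K))"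
  by (simp add: ext_boundary_def to_fract_sum to_fract_power ext_basis_to_fract[symmetric])

lemma to_quotient_field_nth [simp]: "to_quotient_field \<xi> $ i = to_fract (\<xi> $ i)"
  by (simp add: to_quotient_field_def to_fract_def)

lemma linear_form_to_quotient_field:
  "linear_form (to_quotient_field \<xi>) = (\<lambda>K. to_fract (linear_form \<xi> K))"
  by (simp add: linear_form_def to_fract_sum ext_gen_def ext_basis_to_fract[symmetric])

text \<open>Induction over the finite index type. It is used both for the coordinates of a vector
  and for the coefficients of an element of the exterior algebra.\<close>

lemma common_denominator:
  fixes x :: "'a::finite \<Rightarrow> 'r::idom fract"
  obtains d y where "d \<noteq> 0" and "\<And>a. to_fract d * x a = to_fract (y a)"
proof -
  have "\<exists>d. d \<noteq> 0 \<and> (\<forall>a\<in>A. \<exists>r. to_fract d * x a = to_fract r)" if "finite A" for A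
    using that
  proof (induction A)
    case empty
    show ?case by (intro exI[of _ 1]) simp
  next
    case (insert a A)
    then obtain d where d: "d \<noteq> 0" "\<forall>b\<in>A. \<exists>r. to_fract d * x b = to_fract r" by blast
    obtain p q where pq: "x a = Fract p q" "q \<noteq> 0" by (cases "x a") auto
    then have q: "to_fract q * x a = to_fract p"
      by (simp add: to_fract_def eq_fract mult_ac)
    \<comment> \<open>The denominator q of the new entry joins the denominator d of the earlier
      ones.\<close>
    have "\<exists>r. to_fract (q * d) * x b = to_fract r" if b: "b \<in> insert a A" for b
    proof (cases "b = a")
      case True
      have "to_fract (q * d) * x a = to_fract d * (to_fract q * x a)" by (simp add: mult_ac)
      also have "\<dots> = to_fract (d * p)" by (simp add: q)
      finally show ?thesis using True by blast
    next
      case False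
      with b d(2) obtain r where "to_fract d * x b = to_fract r" by blast
      then have "to_fract (q * d) * x b = to_fract (q * r)" by (simp add: mult.assoc)
      then show ?thesis by blast
    qed
    then show ?case using d(1) pq(2) by (intro exI[of _ "q * d"]) auto
  qed
  from this[OF finite[of UNIV]] show ?thesis using that by (metis UNIV_I)
qed

text \<open>The preimage over R of the ideal over F is itself an ideal, and it contains the
  boundaries of circuits.\<close>

lemma to_fract_in_os_ideal:
  assumes "x \<in> os_ideal \<GG>"
  shows "(\<lambda>K. to_fract (x K)) \<in> os_ideal \<GG>"
proof -
  have "os_ideal \<GG> \<subseteq> {x. (\<lambda>K. to_fract (x K)) \<in> os_ideal \<GG>}"
  proof (rule os_ideal_minimal[OF ideal_ext_algebraI])
  qed (auto simp: wedge_to_fract[symmetric] ext_boundary_to_fract[symmetric] os_ideal_zero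
      os_ideal_add os_ideal_wedge_left os_ideal_wedge_right ext_boundary_in_os_ideal)
  with assms show ?thesis by blast
qed

text \<open>This is a converse of \<open>to_fract_in_os_ideal\<close> up to a nonzero scalar c,
  which may depend on x.\<close>

lemma os_ideal_clear_denominators:
  fixes x :: "'n::{finite,linorder} set \<Rightarrow> 'r::idom fract"
  assumes "x \<in> os_ideal \<GG>"
  obtains c y where "c \<noteq> 0" "y \<in> os_ideal \<GG>" "\<And>K. to_fract c * x K = to_fract (y K)"
proof -
  let ?P = "\<lambda>x c y. c \<noteq> (0::'r) \<and> y \<in> os_ideal \<GG> \<and> (\<lambda>K. to_fract c * x K) = (\<lambda>K. to_fract (y K))"
  let ?J = "{x. \<exists>c y. ?P x c y}"
  have "os_ideal \<GG> \<subseteq> ?J"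
  proof (rule os_ideal_minimal[OF ideal_ext_algebraI])
    have "?P (\<lambda>K. 0) 1 (\<lambda>K. 0)" by (simp add: os_ideal_zero)
    then show "(\<lambda>K. 0) \<in> ?J" by blast
  next
    fix C assume "C \<in> \<GG>"
    then have "?P (ext_boundary C) 1 (ext_boundary C)"
      by (simp add: ext_boundary_in_os_ideal ext_boundary_to_fract[symmetric])
    then show "ext_boundary C \<in> ?J" by blast
  next
    fix u v assume "u \<in> ?J" "v \<in> ?J"
    then obtain c y d z where u: "?P u c y" and v: "?P v d z" by blast
    \<comment> \<open>As for a sum of fractions: over the denominator \<open>c * d\<close> the
      numerator is \<open>d * y + c * z\<close>.\<close>
    have "to_fract (c * d) * (u K + v K) = to_fract (d * y K + c * z K)" for K
    proof -
      have "to_fract (c * d) * (u K + v K) = to_fract d * (to_fract c * u K) + to_fract c * (to_fract d * v K)"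
        by (simp add: algebra_simps)
      also have "\<dots> = to_fract (d * y K + c * z K)"
        using u v by (simp add: fun_eq_iff)
      finally show ?thesis .
    qed
    then have "?P (\<lambda>K. u K + v K) (c * d) (\<lambda>K. d * y K + c * z K)"
      using u v by (simp add: os_ideal_add os_ideal_scale)
    then show "(\<lambda>K. u K + v K) \<in> ?J" by blast
  next
    fix u and a :: "'n set \<Rightarrow> 'r fract" assume "u \<in> ?J"
    then obtain c y where u: "?P u c y" by blast
    \<comment> \<open>The factor \<open>a\<close> has coefficients in F, but only finitely many, so
      it has its own denominator d; then \<open>c * d\<close> clears both products.\<close>
    obtain d b where d: "d \<noteq> 0" and b: "\<And>K. to_fract d * a K = to_fract (b K)"
      by (rule common_denominator[of a]) blast
    have uK: "to_fract c * u K = to_fract (y K)" for K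
      using u by (simp add: fun_eq_iff)
    have "to_fract (c * d) * wedge a u K = wedge (\<lambda>K. to_fract d * a K) (\<lambda>K. to_fract c * u K) K"
      "to_fract (c * d) * wedge u a K = wedge (\<lambda>K. to_fract c * u K) (\<lambda>K. to_fract d * a K) K" for K
      by (simp_all add: wedge_def sum_distrib_left mult_ac)
    then have "?P (wedge a u) (c * d) (wedge b y)" "?P (wedge u a) (c * d) (wedge y b)"
      using u d by (simp_all add: b uK wedge_to_fract os_ideal_wedge_left os_ideal_wedge_right)
    then show "wedge a u \<in> ?J" "wedge u a \<in> ?J" by blast+
  qed
  with assms obtain c y where "?P x c y" by blast
  then show ?thesis using that[of c y] by (simp add: fun_eq_iff)
qed


section \<open>Resonant pairs\<close>

lemma vec_parallel_to_quotient_field: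
  "vec_parallel (to_quotient_field \<xi>) (to_quotient_field \<nu>) \<longleftrightarrow> vec_parallel \<xi> \<nu>"
  by (simp add: vec_parallel_def to_fract_mult[symmetric] to_fract_diff[symmetric] del: to_fract_mult to_fract_diff)

lemma vec_parallel_scale:
  fixes \<xi> \<nu> :: "'s::idom ^ 'n"
  assumes "c \<noteq> 0"
  shows "vec_parallel (c *s \<xi>) \<nu> \<longleftrightarrow> vec_parallel \<xi> \<nu>"
  using assms by (simp add: vec_parallel_def mult.assoc mult.left_commute[of _ c] right_diff_distrib[symmetric])

lemma vec_parallel_iff_span:
  fixes \<xi> \<nu> :: "'k::field ^ 'n"
  assumes "\<nu> \<noteq> 0"
  shows "vec_parallel \<xi> \<nu> \<longleftrightarrow> \<xi> \<in> vec.span {\<nu>}"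
proof
  assume par: "vec_parallel \<xi> \<nu>"
  \<comment> \<open>A nonzero coordinate fixes the proportionality factor; the minors involving i
    force it on all other coordinates.\<close>
  obtain i where i: "\<nu> $ i \<noteq> 0" using assms by (auto simp: vec_eq_iff)
  have "\<xi> = (\<xi> $ i / \<nu> $ i) *s \<nu>"
    using par i by (simp add: vec_eq_iff vec_parallel_def field_simps)
  then show "\<xi> \<in> vec.span {\<nu>}" by (auto simp: vec.span_singleton)
qed (auto simp: vec.span_singleton vec_parallel_def)

text \<open>\<open>vec.dim\<close> of a set is the dimension of its span. Containment in a line
  therefore bounds it by 1, and an independent pair inside the set bounds it below by 2.\<close>

lemma dim_Z_set_ge_2_iff:
  fixes \<xi> :: "'k::field ^ 'n::{finite,linorder}"
  assumes "\<xi> \<noteq> 0"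
  shows "vec.dim (Z_set \<GG> \<xi>) \<ge> 2 \<longleftrightarrow> (\<exists>\<eta>. resonant_pair \<GG> \<xi> \<eta>)"
proof
  assume dim: "vec.dim (Z_set \<GG> \<xi>) \<ge> 2"
  have "\<not> Z_set \<GG> \<xi> \<subseteq> vec.span {\<xi>}"
  proof
    assume "Z_set \<GG> \<xi> \<subseteq> vec.span {\<xi>}"
    then have "vec.dim (Z_set \<GG> \<xi>) \<le> card {\<xi>}" by (rule vec.dim_le_card) simp
    with dim show False by simp
  qed
  then show "\<exists>\<eta>. resonant_pair \<GG> \<xi> \<eta>"
    using assms by (auto simp: resonant_pair_def vec_parallel_iff_span)
next
  assume "\<exists>\<eta>. resonant_pair \<GG> \<xi> \<eta>"
  then obtain \<eta> where \<eta>: "\<eta> \<in> Z_set \<GG> \<xi>" "\<eta> \<notin> vec.span {\<xi>}"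
    using assms by (auto simp: resonant_pair_def vec_parallel_iff_span)
  then have "vec.independent {\<eta>, \<xi>}"
    using assms by (simp add: vec.independent_insert vec.dependent_single)
  then have "card {\<eta>, \<xi>} \<le> vec.dim (Z_set \<GG> \<xi>)"
    using \<eta>(1) by (intro vec.independent_card_le_dim) (auto simp: Z_set_self)
  \<comment> \<open>Distinctness is what makes the cardinality of the pair equal to 2.\<close>
  moreover have "\<eta> \<noteq> \<xi>" using \<eta>(2) vec.span_base[of \<xi> "{\<xi>}"] by auto
  ultimately show "vec.dim (Z_set \<GG> \<xi>) \<ge> 2" by simp
qed

lemma resonant_pair_to_quotient_field:
  assumes "resonant_pair \<GG> \<xi> \<eta>"
  shows "resonant_pair \<GG> (to_quotient_field \<xi>) (to_quotient_field \<eta>)"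
  using assms unfolding resonant_pair_def Z_set_iff vec_parallel_to_quotient_field
  by (simp add: linear_form_to_quotient_field wedge_to_fract to_fract_in_os_ideal)

text \<open>Denominators are cleared twice: d makes the vector \<eta> integral, then c brings the
  relation it satisfies into the ideal over R. The witness is \<open>c *s \<nu>\<close>, where \<nu>
  is d times \<eta>.\<close>

lemma resonant_pair_clear_denominators:
  fixes \<xi> :: "'r::idom ^ 'n::{finite,linorder}"
  assumes res: "resonant_pair \<GG> (to_quotient_field \<xi>) \<eta>"
  shows "\<exists>\<nu>. resonant_pair \<GG> \<xi> \<nu>"
proof -
  obtain d y where d: "d \<noteq> 0" and y: "\<And>i. to_fract d * \<eta> $ i = to_fract (y i)"
    by (rule common_denominator[of "\<lambda>i. \<eta> $ i"]) blast
  define \<nu> where "\<nu> = (\<chi> i. y i)"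
  have \<nu>: "to_quotient_field \<nu> = to_fract d *s \<eta>"
    by (simp add: vec_eq_iff \<nu>_def y)
  have scale: "linear_form (c *s \<zeta>) = (\<lambda>K. c * linear_form \<zeta> K)" for c and \<zeta> :: "'s::comm_ring_1 ^ 'n::{finite,linorder}"
    by (simp add: linear_form_def sum_distrib_left mult.assoc)
  have "(\<lambda>K. to_fract (wedge (linear_form \<xi>) (linear_form \<nu>) K)) =
      wedge (linear_form (to_quotient_field \<xi>)) (linear_form (to_quotient_field \<nu>))"
    by (simp add: linear_form_to_quotient_field wedge_to_fract)
  also have "\<dots> \<in> os_ideal \<GG>"
    using res unfolding \<nu> scale wedge_scale_right
    by (simp add: resonant_pair_def Z_set_iff os_ideal_scale)
  finally obtain c z where c: "c \<noteq> 0" and z: "z \<in> os_ideal \<GG>"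
    and eq: "\<And>K. to_fract c * to_fract (wedge (linear_form \<xi>) (linear_form \<nu>) K) = to_fract (z K)"
    using os_ideal_clear_denominators by blast
  \<comment> \<open>Injectivity of \<open>to_fract\<close> brings the equation down to R.\<close>
  have "z K = c * wedge (linear_form \<xi>) (linear_form \<nu>) K" for K
    using eq[of K] by (simp add: to_fract_mult[symmetric] del: to_fract_mult)
  \<comment> \<open>The product is linear in its second factor, so c can be absorbed into
    \<nu>.\<close>
  with z have "c *s \<nu> \<in> Z_set \<GG> \<xi>"
    unfolding Z_set_iff scale wedge_scale_right by (metis ext)
  \<comment> \<open>Nonzero scalars of a domain preserve nonparallelism, and so does the embedding
    into F.\<close>
  moreover have "\<not> vec_parallel (c *s \<nu>) \<xi>"
    using res d c by (simp add: resonant_pair_def vec_parallel_scale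
        vec_parallel_to_quotient_field[of \<nu>, symmetric] \<nu>)
  ultimately show ?thesis by (auto simp: resonant_pair_def)
qed

theorem theorem2p6:
  fixes H :: "'n::{finite,linorder} \<Rightarrow> (complex ^ 'l) set"
  assumes "hyperplane_arrangement H"
  shows "resonance_depth 1 (arr_matroid H) - {0} = (resonance (arr_matroid H) :: ('r::idom ^ 'n::{finite,linorder}) set)"
proof (rule Set.set_eqI)
  fix \<xi> :: "'r ^ 'n::{finite,linorder}"
  let ?G = "arr_matroid H"
  show "\<xi> \<in> resonance_depth 1 ?G - {0} \<longleftrightarrow> \<xi> \<in> resonance ?G"
  proof (cases "\<xi> = 0")
    \<comment> \<open>Zero is removed on the left; on the right it is parallel to every vector and
      so has no resonant partner.\<close>
    case True
    then show ?thesis by (simp add: resonance_def resonant_pair_def vec_parallel_def)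
  next
    case False
    then have "to_quotient_field \<xi> \<noteq> 0" by (simp add: vec_eq_iff)
    \<comment> \<open>For k = 1 the bound \<open>k + 1\<close> is the 2 of
      \<open>dim_Z_set_ge_2_iff\<close>, applied over F.\<close>
    then have "\<xi> \<in> resonance_depth 1 ?G \<longleftrightarrow> (\<exists>\<eta>. resonant_pair ?G (to_quotient_field \<xi>) \<eta>)"
      by (simp add: resonance_depth_def dim_Z_set_ge_2_iff[symmetric] numeral_2_eq_2)
    also have "\<dots> \<longleftrightarrow> \<xi> \<in> resonance ?G"
      using resonant_pair_to_quotient_field resonant_pair_clear_denominators
      unfolding resonance_def by blast
    finally show ?thesis using False by simp
  qed
qed

end
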